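(* Let $H$ be a triangle-free graph. Then the problem $\textsc{LHom}(H)$ can be solved in polynomial time on input graphs of diameter at most $2$.
   Context: All graphs are finite and simple (no loops). For a fixed graph $H$, in the list homomorphism problem $\textsc{LHom}(H)$ the input is a graph $G$ together with lists $L: V(G)\to 2^{V(H)}$, and the question is whether there is a mapping $\varphi: V(G)\to V(H)$ with $\varphi(v)\in L(v)$ for all $v\in V(G)$ and $\varphi(u)\varphi(v)\in E(H)$ for every edge $uv\in E(G)$. The diameter of $G$ is the maximum over pairs of vertices of their distance in $G$. *)

theory Defs
  imports
    "Graph_Theory.Graph_Theory"
    "HOL-Library.Extended_Nat"
    "HOL-Computational_Algebra.Polynomial"
begin

text \<open>
  Finite simple graphs are modelled by the locale \<open>pair_graph\<close>: a finite vertex set and a finite,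
  symmetric, loop-free set of arcs, the undirected edge \<open>uv\<close> being the pair of arcs
  \<open>(u, v)\<close> and \<open>(v, u)\<close>.
\<close>

definition triangle_free :: "'a pair_pre_digraph \<Rightarrow> bool" where
  "triangle_free H \<longleftrightarrow>
     \<not> (\<exists>a b c. (a, b) \<in> parcs H \<and> (b, c) \<in> parcs H \<and> (a, c) \<in> parcs H)"

text \<open>The distance of two vertices in different components is \<open>\<infinity>\<close>, and so is then the diameter.\<close>

definition graph_distance :: "'a pair_pre_digraph \<Rightarrow> 'a \<Rightarrow> 'a \<Rightarrow> enat" where
  "graph_distance G u v = (INF p \<in> {p. pre_digraph.awalk (with_proj G) u p v}. enat (length p))"

definition graph_diameter :: "'a pair_pre_digraph \<Rightarrow> enat" where
  "graph_diameter G = (SUP (u, v) \<in> pverts G \<times> pverts G. graph_distance G u v)"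

definition list_homomorphism ::
  "'b pair_pre_digraph \<Rightarrow> 'a pair_pre_digraph \<Rightarrow> ('b \<Rightarrow> 'a set) \<Rightarrow> ('b \<Rightarrow> 'a) \<Rightarrow> bool" where
  "list_homomorphism G H L \<phi> \<longleftrightarrow>
     (\<forall>v \<in> pverts G. \<phi> v \<in> pverts H \<and> \<phi> v \<in> L v) \<and>
     (\<forall>(u, v) \<in> parcs G. (\<phi> u, \<phi> v) \<in> parcs H)"

text \<open>
  As inputs to an algorithm, graphs have an initial segment of the natural numbers as vertex set.
\<close>

type_synonym 'a lhom_input = "nat pair_pre_digraph \<times> (nat \<Rightarrow> 'a set)"

definition lhom_instances :: "'a pair_pre_digraph \<Rightarrow> 'a lhom_input set" where
  "lhom_instances H =
     {(G, L). pair_graph G \<and> pverts G = {..<card (pverts G)} \<and> (\<forall>v \<in> pverts G. L v \<subseteq> pverts H)}"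

definition lhom_yes :: "'a pair_pre_digraph \<Rightarrow> 'a lhom_input \<Rightarrow> bool" where
  "lhom_yes H = (\<lambda>(G, L). \<exists>\<phi>. list_homomorphism G H L \<phi>)"

text \<open>
  The input string consists of the number of vertices of \<open>G\<close> in unary, a separator, the rows of the
  adjacency matrix of \<open>G\<close>, and, for each vertex of \<open>G\<close>, the characteristic vector of its list
  with respect to an enumeration \<open>hs\<close> of the vertices of \<open>H\<close>.
\<close>

definition lhom_encode :: "'a list \<Rightarrow> 'a lhom_input \<Rightarrow> bool list" where
  "lhom_encode hs = (\<lambda>(G, L). let n = card (pverts G) in
     replicate n True @ [False] @
     [(u, v) \<in> parcs G. u \<leftarrow> [0..<n], v \<leftarrow> [0..<n]] @
     [h \<in> L v. v \<leftarrow> [0..<n], h \<leftarrow> hs])"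

text \<open>
  Polynomial time is defined by random access machines with registers and an indirectly addressed
  memory, both holding natural numbers. Every instruction costs one step. As there is no
  multiplication or shift, numbers grow by at most one bit per step, so that this unit cost measure
  is polynomially equivalent to the logarithmic one and to time on Turing machines.
\<close>

datatype instr =
    Const nat nat        \<comment> \<open>\<open>R a := k\<close>\<close>
  | Plus nat nat nat     \<comment> \<open>\<open>R a := R b + R c\<close>\<close>
  | Minus nat nat nat    \<comment> \<open>\<open>R a := R b - R c\<close>, truncated at 0\<close>
  | Load nat nat         \<comment> \<open>\<open>R a := M (R b)\<close>\<close>
  | Store nat nat        \<comment> \<open>\<open>M (R a) := R b\<close>\<close>
  | Jump nat             \<comment> \<open>absolute jump\<close>
  | JumpZero nat nat     \<comment> \<open>jump to the second argument if \<open>R a = 0\<close>\<close>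

type_synonym ram_program = "instr list"

record ram_config =
  pc :: nat
  regs :: "nat \<Rightarrow> nat"
  mem :: "nat \<Rightarrow> nat"

fun exec_instr :: "instr \<Rightarrow> ram_config \<Rightarrow> ram_config" where
  "exec_instr (Const a k) s = s\<lparr>pc := pc s + 1, regs := (regs s)(a := k)\<rparr>"
| "exec_instr (Plus a b c) s = s\<lparr>pc := pc s + 1, regs := (regs s)(a := regs s b + regs s c)\<rparr>"
| "exec_instr (Minus a b c) s = s\<lparr>pc := pc s + 1, regs := (regs s)(a := regs s b - regs s c)\<rparr>"
| "exec_instr (Load a b) s = s\<lparr>pc := pc s + 1, regs := (regs s)(a := mem s (regs s b))\<rparr>"
| "exec_instr (Store a b) s = s\<lparr>pc := pc s + 1, mem := (mem s)(regs s a := regs s b)\<rparr>"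
| "exec_instr (Jump l) s = s\<lparr>pc := l\<rparr>"
| "exec_instr (JumpZero a l) s = s\<lparr>pc := (if regs s a = 0 then l else pc s + 1)\<rparr>"

definition halted :: "ram_program \<Rightarrow> ram_config \<Rightarrow> bool" where
  "halted P s \<longleftrightarrow> length P \<le> pc s"

definition ram_step :: "ram_program \<Rightarrow> ram_config \<Rightarrow> ram_config" where
  "ram_step P s = (if halted P s then s else exec_instr (P ! pc s) s)"

definition ram_run :: "ram_program \<Rightarrow> nat \<Rightarrow> ram_config \<Rightarrow> ram_config" where
  "ram_run P t = ram_step P ^^ t"

text \<open>The machine starts with the input bits in memory and their number in register 0.\<close>

definition ram_init :: "bool list \<Rightarrow> ram_config" where
  "ram_init x =
     \<lparr>pc = 0,
      regs = (\<lambda>_. 0)(0 := length x),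
      mem = (\<lambda>i. if i < length x then of_bool (x ! i) else 0)\<rparr>"

text \<open>
  The decision problem \<open>Q\<close>, with inputs encoded by \<open>enc\<close>, is solved in polynomial time on the
  inputs in \<open>D\<close>. Halted configurations are fixed points of \<open>ram_step\<close>, so running for a given
  number of steps and being halted means halting within that number of steps; the answer is the
  final content of register 0.
\<close>

definition poly_time_solvable_on :: "('i \<Rightarrow> bool list) \<Rightarrow> 'i set \<Rightarrow> ('i \<Rightarrow> bool) \<Rightarrow> bool" where
  "poly_time_solvable_on enc D Q \<longleftrightarrow>
     (\<exists>(P :: ram_program) (q :: nat poly). \<forall>x \<in> D.
        let s = ram_run P (poly q (length (enc x))) (ram_init (enc x))
        in halted P s \<and> regs s 0 = of_bool (Q x))"

end

theory Submission
  imports Defs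
begin

text \<open>
  Let \<open>\<phi> : G \<rightarrow> H\<close> be a homomorphism, where \<open>G\<close> has diameter at most 2 and \<open>H\<close> is triangle-free.
  If \<open>\<phi> u\<close> and \<open>\<phi> v\<close> are adjacent then so are \<open>u\<close> and \<open>v\<close>, since the image of a common neighbour
  of \<open>u\<close> and \<open>v\<close> would complete a triangle. Hence vertices with equal image are twins, and \<open>\<phi>\<close> is
  determined, up to harmless choices, by one representative \<open>r h\<close> in \<open>G\<close> of each \<open>h\<close> in the image:
  every map that sends each \<open>u\<close> to some \<open>h \<in> L u\<close> adjacent to exactly those \<open>h'\<close> for which \<open>u\<close> is
  adjacent to \<open>r h'\<close> is a homomorphism. The existence of such representatives is a first-order
  property of the input, with a number of quantifiers depending only on \<open>H\<close>, and such properties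
  are decided in polynomial time by nested loops.
\<close>

section \<open>Homomorphisms from graphs of diameter two\<close>

text \<open>A distance at most 2 is witnessed by a walk with at most two arcs. The empty walk and
  the single arc are excluded by \<open>u \<noteq> v\<close> and non-adjacency, so the middle vertex
  of the walk is the common neighbour.\<close>

lemma graph_diameter_le_2D:
  assumes "graph_diameter G \<le> 2" "u \<in> pverts G" "v \<in> pverts G" "u \<noteq> v" "(u, v) \<notin> parcs G"
  shows "\<exists>w. (u, w) \<in> parcs G \<and> (w, v) \<in> parcs G"
proof -
  let ?W = "{p. pre_digraph.awalk (with_proj G) u p v}"
  have "graph_distance G u v \<le> graph_diameter G"
    unfolding graph_diameter_def using assms(2,3) by (intro SUP_upper2[of "(u, v)"]) auto
  then have le: "graph_distance G u v \<le> 2" using assms(1) by simp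
  \<comment> \<open>Otherwise every walk has length at least 3 and so has the infimum; this includes
    the case without any walk, where the infimum is infinite.\<close>
  have "\<exists>p\<in>?W. enat (length p) < 3"
  proof (rule ccontr)
    assume "\<not> ?thesis"
    then have "3 \<le> graph_distance G u v"
      unfolding graph_distance_def by (intro INF_greatest) (auto simp: not_less)
    then have "(3::enat) \<le> 2" using le by (rule order_trans)
    then show False by (simp add: numeral_eq_enat)
  qed
  then obtain p where p: "pre_digraph.awalk (with_proj G) u p v" and len: "length p < 3"
    by (auto simp: numeral_eq_enat)
  show ?thesis
  proof (cases p)
    case Nil
    then show ?thesis using p assms(4)
      by (auto simp: pre_digraph.awalk_def pre_digraph.cas.simps)
  next
    case (Cons e q)
    show ?thesis
    proof (cases q)
      case Nil
      then show ?thesis using p Cons assms(5)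
        by (cases e) (auto simp: pre_digraph.awalk_def pre_digraph.cas.simps)
    next
      case (Cons f q')
      then have "p = [e, f]" using \<open>p = e # q\<close> len by simp
      then show ?thesis using p
        by (cases e; cases f) (auto simp: pre_digraph.awalk_def pre_digraph.cas.simps)
    qed
  qed
qed

lemma homomorphism_reflects_adjacency:
  assumes "pair_graph G" "pair_graph H" "triangle_free H" "graph_diameter G \<le> 2"
    and hom: "list_homomorphism G H L \<phi>" and "u \<in> pverts G" "v \<in> pverts G"
  shows "(\<phi> u, \<phi> v) \<in> parcs H \<longleftrightarrow> (u, v) \<in> parcs G"
proof
  interpret G: pair_graph G by fact
  interpret H: pair_graph H by fact
  assume e: "(\<phi> u, \<phi> v) \<in> parcs H"
  show "(u, v) \<in> parcs G"
  proof (rule ccontr)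
    assume ne: "(u, v) \<notin> parcs G"
    \<comment> \<open>If \<open>u = v\<close>, the edge \<open>e\<close> would be a loop of
      \<open>H\<close>.\<close>
    have "u \<noteq> v" using e H.no_loops by fastforce
    from graph_diameter_le_2D[OF assms(4,6,7) this ne] obtain w
      where "(u, w) \<in> parcs G" "(w, v) \<in> parcs G" by blast
    then have "(\<phi> u, \<phi> w) \<in> parcs H" "(\<phi> w, \<phi> v) \<in> parcs H"
      using hom by (auto simp: list_homomorphism_def)
    then show False using e assms(3) by (auto simp: triangle_free_def)
  qed
qed (use hom in \<open>auto simp: list_homomorphism_def\<close>)

text \<open>With \<open>r h'\<close> read as a vertex mapped to \<open>h'\<close>, this says that
  \<open>h\<close> is a possible image of \<open>u\<close> as far as the representatives can
  tell.\<close>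

definition candidate ::
  "'b pair_pre_digraph \<Rightarrow> 'a pair_pre_digraph \<Rightarrow> ('b \<Rightarrow> 'a set) \<Rightarrow> ('a \<Rightarrow> 'b) \<Rightarrow> 'a \<Rightarrow> 'b \<Rightarrow> bool"
where
  "candidate G H L r h u \<longleftrightarrow>
     h \<in> L u \<and> (\<forall>h' \<in> pverts H. r h' \<in> pverts G \<longrightarrow> ((h, h') \<in> parcs H \<longleftrightarrow> (u, r h') \<in> parcs G))"

text \<open>A value \<open>r h\<close> outside of \<open>G\<close> expresses that \<open>h\<close> is not in the image.\<close>

definition representatives ::
  "'b pair_pre_digraph \<Rightarrow> 'a pair_pre_digraph \<Rightarrow> ('b \<Rightarrow> 'a set) \<Rightarrow> ('a \<Rightarrow> 'b) \<Rightarrow> bool" where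
  "representatives G H L r \<longleftrightarrow>
     (\<forall>u \<in> pverts G. \<exists>h \<in> pverts H. r h \<in> pverts G \<and> candidate G H L r h u) \<and>
     (\<forall>u \<in> pverts G. \<forall>v \<in> pverts G. (u, v) \<in> parcs G \<longrightarrow>
        (\<forall>h \<in> pverts H. \<forall>h' \<in> pverts H. (h, h') \<notin> parcs H \<longrightarrow>
           \<not> (r h \<in> pverts G \<and> r h' \<in> pverts G \<and>
              candidate G H L r h u \<and> candidate G H L r h' v)))"

text \<open>The second part of \<open>representatives\<close> speaks of all candidates of the two
  ends of an edge, so an image can be chosen for each vertex independently.\<close>

lemma representatives_imp_homomorphism:
  assumes "pair_graph G" "representatives G H L r"
  shows "\<exists>\<phi>. list_homomorphism G H L \<phi>"
proof -
  interpret G: pair_graph G by fact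
  obtain \<phi> where \<phi>: "\<And>u. u \<in> pverts G \<Longrightarrow>
      \<phi> u \<in> pverts H \<and> r (\<phi> u) \<in> pverts G \<and> candidate G H L r (\<phi> u) u"
    using assms(2) unfolding representatives_def by metis
  have "list_homomorphism G H L \<phi>"
    unfolding list_homomorphism_def
  proof (intro conjI ballI)
    fix e assume e: "e \<in> parcs G"
    obtain u v where uv: "e = (u, v)" by (cases e)
    then have "u \<in> pverts G" "v \<in> pverts G"
      using e G.in_arcsD1 G.in_arcsD2 by auto
    then show "case e of (u, v) \<Rightarrow> (\<phi> u, \<phi> v) \<in> parcs H"
      using assms(2) \<phi>[of u] \<phi>[of v] e uv unfolding representatives_def by blast
  qed (use \<phi> in \<open>auto simp: candidate_def\<close>)
  then show ?thesis by blast
qed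

lemma homomorphism_imp_representatives:
  assumes G: "pair_graph G" and H: "pair_graph H" and "triangle_free H" "graph_diameter G \<le> 2"
    and hom: "list_homomorphism G H L \<phi>"
    and z: "z \<notin> pverts G"
  shows "\<exists>r. (\<forall>h. r h \<in> insert z (pverts G)) \<and> representatives G H L r"
proof -
  interpret G: pair_graph G by fact
  interpret H: pair_graph H by fact
  note full = homomorphism_reflects_adjacency[OF assms(1-5)]
  \<comment> \<open>A preimage under \<open>\<phi>\<close> represents each \<open>h\<close> in the
    image; \<open>z\<close>, being outside of \<open>G\<close>, marks all other
    \<open>h\<close>.\<close>
  define r where
    "r h = (if \<exists>u \<in> pverts G. \<phi> u = h then SOME u. u \<in> pverts G \<and> \<phi> u = h else z)" for h
  have r1: "r (\<phi> u) \<in> pverts G \<and> \<phi> (r (\<phi> u)) = \<phi> u" if "u \<in> pverts G" for u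
  proof -
    have "\<exists>w. w \<in> pverts G \<and> \<phi> w = \<phi> u" using that by blast
    from someI_ex[OF this] show ?thesis using that by (auto simp: r_def)
  qed
  have r2: "\<exists>u \<in> pverts G. \<phi> u = h" if "r h \<in> pverts G" for h
    using that z by (auto simp: r_def split: if_splits)
  have r3: "\<phi> (r h) = h" if "r h \<in> pverts G" for h
    using r1 r2[OF that] by auto
  have rV: "r h \<in> insert z (pverts G)" for h
  proof (cases "\<exists>u \<in> pverts G. \<phi> u = h")
    case True
    then show ?thesis using r1 by auto
  next
    case False
    then show ?thesis by (auto simp: r_def)
  qed
  have sym: "(b, a) \<in> parcs H" if "(a, b) \<in> parcs H" for a b
    using that H.graph_symmetric by auto
  have "representatives G H L r"
    unfolding representatives_def
  proof (intro conjI ballI impI notI, goal_cases)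
    case (1 u)
    have "candidate G H L r (\<phi> u) u"
      unfolding candidate_def
    proof (intro conjI ballI impI)
      fix h' assume "r h' \<in> pverts G"
      then show "(\<phi> u, h') \<in> parcs H \<longleftrightarrow> (u, r h') \<in> parcs G"
        using full[OF 1, of "r h'"] r3 by simp
    qed (use hom 1 in \<open>auto simp: list_homomorphism_def\<close>)
    then show ?case using r1[OF 1] hom 1 by (auto simp: list_homomorphism_def)
  next
    case (2 u v h h')
    \<comment> \<open>The edge \<open>uv\<close> is transported in turns between the graphs:
      \<open>u\<close> is adjacent to \<open>r (\<phi> v)\<close>, hence \<open>h\<close> to
      \<open>\<phi> v\<close> since \<open>h\<close> is a candidate for \<open>u\<close>, hence
      \<open>v\<close> to \<open>r h\<close>, hence \<open>h'\<close> to \<open>h\<close> since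
      \<open>h'\<close> is a candidate for \<open>v\<close>.\<close>
    have \<phi>v: "\<phi> v \<in> pverts H" using hom 2 by (auto simp: list_homomorphism_def)
    have "(\<phi> u, \<phi> v) \<in> parcs H" using full 2 by simp
    then have "(u, r (\<phi> v)) \<in> parcs G" using full[of u "r (\<phi> v)"] r1[of v] 2 by simp
    then have "(h, \<phi> v) \<in> parcs H" using 2 r1[of v] \<phi>v by (auto simp: candidate_def)
    then have "(\<phi> v, \<phi> (r h)) \<in> parcs H" using r3 2 sym by simp
    then have "(v, r h) \<in> parcs G" using full[of v "r h"] 2 by simp
    then have "(h', h) \<in> parcs H" using 2 by (auto simp: candidate_def)
    then show ?case using sym 2 by blast
  qed
  with rV show ?thesis by blast
qed

section \<open>Arithmetic terms with bounded sums and their compilation\<close>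

text \<open>Variables are de Bruijn indices; \<open>Sum\<close> binds one variable ranging over \<open>{..<N}\<close>.\<close>

datatype tm =
    Cst nat
  | Var nat
  | Add tm tm
  | Sub tm tm
  | Ld tm
  | Sum tm

fun eval :: "(nat \<Rightarrow> nat) \<Rightarrow> nat \<Rightarrow> (nat \<Rightarrow> nat) \<Rightarrow> tm \<Rightarrow> nat" where
  "eval M N \<rho> (Cst k) = k"
| "eval M N \<rho> (Var x) = \<rho> x"
| "eval M N \<rho> (Add a b) = eval M N \<rho> a + eval M N \<rho> b"
| "eval M N \<rho> (Sub a b) = eval M N \<rho> a - eval M N \<rho> b"
| "eval M N \<rho> (Ld a) = M (eval M N \<rho> a)"
| "eval M N \<rho> (Sum a) = (\<Sum>i<N. eval M N (case_nat i \<rho>) a)"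

fun code_length :: "tm \<Rightarrow> nat" where
  "code_length (Cst k) = 1"
| "code_length (Var x) = 2"
| "code_length (Add a b) = code_length a + code_length b + 1"
| "code_length (Sub a b) = code_length a + code_length b + 1"
| "code_length (Ld a) = code_length a + 1"
| "code_length (Sum a) = code_length a + 7"

text \<open>
  The code of a term, placed at address \<open>p\<close>, leaves the value in register \<open>d\<close> and preserves the
  registers below \<open>d\<close>, among which are those that hold the variables, given by \<open>vs\<close>, and register
  \<open>0\<close>, which holds \<open>N\<close>.
\<close>

fun compile :: "(nat \<Rightarrow> nat) \<Rightarrow> nat \<Rightarrow> nat \<Rightarrow> tm \<Rightarrow> instr list" where
  "compile vs d p (Cst k) = [Const d k]"
| "compile vs d p (Var x) = [Const d 0, Plus d d (vs x)]"
| "compile vs d p (Add a b) =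
     compile vs d p a @ compile vs (d + 1) (p + code_length a) b @ [Plus d d (d + 1)]"
| "compile vs d p (Sub a b) =
     compile vs d p a @ compile vs (d + 1) (p + code_length a) b @ [Minus d d (d + 1)]"
| "compile vs d p (Ld a) = compile vs d p a @ [Load d d]"
| "compile vs d p (Sum a) =
     [Const d 0, Plus (d + 1) d 0, Const (d + 2) 1,
      JumpZero (d + 1) (p + code_length a + 7),
      Minus (d + 1) (d + 1) (d + 2)] @
     compile (case_nat (d + 1) vs) (d + 3) (p + 5) a @
     [Plus d d (d + 3), Jump (p + 3)]"

text \<open>The indeterminate \<open>[:0, 1:]\<close> stands for \<open>N\<close>. A sum costs three
  initial instructions and the last loop test, and in each round the body plus test, decrement,
  addition and jump.\<close>

fun time_poly :: "tm \<Rightarrow> nat poly" where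
  "time_poly (Cst k) = 1"
| "time_poly (Var x) = 2"
| "time_poly (Add a b) = time_poly a + time_poly b + 1"
| "time_poly (Sub a b) = time_poly a + time_poly b + 1"
| "time_poly (Ld a) = time_poly a + 1"
| "time_poly (Sum a) = 4 + [:0, 1:] * (time_poly a + 4)"

lemma length_compile [simp]: "length (compile vs d p t) = code_length t"
  by (induction t arbitrary: vs d p) auto

text \<open>Jumps are absolute, so compiled code is meaningful only at the address it was compiled
  for.\<close>

definition code_at :: "ram_program \<Rightarrow> nat \<Rightarrow> instr list \<Rightarrow> bool" where
  "code_at P p c \<longleftrightarrow> (\<exists>pre post. P = pre @ c @ post \<and> length pre = p)"

lemma code_at_append:
  "code_at P p (c @ c') \<Longrightarrow> code_at P p c \<and> code_at P (p + length c) c'"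
  unfolding code_at_def by (metis append.assoc length_append)

lemma code_at_nth:
  "code_at P p c \<Longrightarrow> i < length c \<Longrightarrow> p + i < length P \<and> P ! (p + i) = c ! i"
  unfolding code_at_def by (auto simp: nth_append)

lemma code_at_Cons:
  "code_at P p (i # c) \<Longrightarrow> p < length P \<and> P ! p = i \<and> code_at P (Suc p) c"
  using code_at_append[of P p "[i]" c] code_at_nth[of P p "i # c" 0] by simp

text \<open>An upper bound on the number of steps suffices, because halted configurations are fixed
  points.\<close>

definition reach :: "ram_program \<Rightarrow> nat \<Rightarrow> ram_config \<Rightarrow> ram_config \<Rightarrow> bool" where
  "reach P T s s' \<longleftrightarrow> (\<exists>t\<le>T. ram_run P t s = s')"

lemma reach_trans: "reach P T s s' \<Longrightarrow> reach P T' s' s'' \<Longrightarrow> reach P (T + T') s s''"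
proof -
  assume "reach P T s s'" "reach P T' s' s''"
  then obtain t t' where "t \<le> T" "ram_run P t s = s'" "t' \<le> T'" "ram_run P t' s' = s''"
    unfolding reach_def by blast
  then have "t + t' \<le> T + T'" "ram_run P (t + t') s = s''"
    by (auto simp: ram_run_def add.commute[of t] funpow_add)
  then show ?thesis unfolding reach_def by blast
qed

lemma reach_mono: "reach P T s s' \<Longrightarrow> T \<le> T' \<Longrightarrow> reach P T' s s'"
  unfolding reach_def using le_trans by blast

lemma reach_instr:
  assumes "p < length P" "P ! p = i" "pc s = p"
  shows "reach P 1 s (exec_instr i s)"
  unfolding reach_def ram_run_def
  by (rule exI[of _ 1]) (use assms in \<open>auto simp: ram_step_def halted_def\<close>)

text \<open>Induction on the term for all \<open>vs\<close>, \<open>d\<close>, \<open>p\<close> and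
  \<open>s\<close>, since subterms run at other addresses, with higher target registers and from
  later states. Preserving the registers below \<open>d\<close> keeps the environment and the loop
  bound in register 0 intact for subsequent code.\<close>

lemma compile_correct:
  assumes "code_at P p (compile vs d p t)" "pc s = p" "\<And>x. vs x < d" "0 < d" "regs s 0 = N"
  shows "\<exists>s'. reach P (poly (time_poly t) N) s s' \<and> pc s' = p + code_length t \<and>
           regs s' d = eval (mem s) N (regs s \<circ> vs) t \<and>
           (\<forall>r<d. regs s' r = regs s r) \<and> mem s' = mem s"
  using assms
proof (induction t arbitrary: vs d p s)
  case (Cst k)
  then have "p < length P" "P ! p = Const d k" by (auto dest!: code_at_Cons)
  from reach_instr[OF this \<open>pc s = p\<close>] show ?case
    using Cst by (intro exI[of _ "exec_instr (Const d k) s"]) auto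
next
  case (Var x)
  then have c: "p < length P" "P ! p = Const d 0"
    "Suc p < length P" "P ! Suc p = Plus d d (vs x)" by (auto dest!: code_at_Cons)
  let ?s1 = "exec_instr (Const d 0) s"
  let ?s2 = "exec_instr (Plus d d (vs x)) ?s1"
  have "reach P 2 s ?s2"
    using reach_trans[OF reach_instr[OF c(1,2) \<open>pc s = p\<close>]
      reach_instr[OF c(3,4), of ?s1]] Var by (simp add: numeral_2_eq_2)
  then show ?case using Var.prems(2-) Var.prems(3)[of x] by (intro exI[of _ ?s2]) auto
next
  case (Add a b)
  then have c: "code_at P p (compile vs d p a)"
    "code_at P (p + code_length a) (compile vs (d + 1) (p + code_length a) b)"
    "code_at P (p + code_length a + code_length b) [Plus d d (d + 1)]"
    by (auto dest!: code_at_append simp: add.assoc)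
  from Add.IH(1)[OF c(1) Add.prems(2-)] obtain s1 where
    s1: "reach P (poly (time_poly a) N) s s1" "pc s1 = p + code_length a"
      "regs s1 d = eval (mem s) N (regs s \<circ> vs) a" "\<forall>r<d. regs s1 r = regs s r"
      "mem s1 = mem s" by blast
  have vs: "regs s1 \<circ> vs = regs s \<circ> vs" using s1(4) Add.prems(3) by auto
  have "\<exists>s'. reach P (poly (time_poly b) N) s1 s' \<and> pc s' = p + code_length a + code_length b \<and>
      regs s' (d + 1) = eval (mem s1) N (regs s1 \<circ> vs) b \<and>
      (\<forall>r<d + 1. regs s' r = regs s1 r) \<and> mem s' = mem s1"
    by (rule Add.IH(2)[OF c(2) s1(2)]) (use Add.prems(3-) s1(4) in \<open>auto intro: less_SucI\<close>)
  then obtain s2 where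
    s2: "reach P (poly (time_poly b) N) s1 s2" "pc s2 = p + code_length a + code_length b"
      "regs s2 (d + 1) = eval (mem s1) N (regs s1 \<circ> vs) b" "\<forall>r<d + 1. regs s2 r = regs s1 r"
      "mem s2 = mem s1" by blast
  let ?s3 = "exec_instr (Plus d d (d + 1)) s2"
  have "reach P 1 s2 ?s3"
    using code_at_Cons[OF c(3)] s2(2) by (intro reach_instr) auto
  from reach_trans[OF reach_trans[OF s1(1) s2(1)] this]
  show ?case using s1 s2 vs by (intro exI[of _ ?s3]) (auto simp: poly_add comp_def)
next
  case (Sub a b)
  then have c: "code_at P p (compile vs d p a)"
    "code_at P (p + code_length a) (compile vs (d + 1) (p + code_length a) b)"
    "code_at P (p + code_length a + code_length b) [Minus d d (d + 1)]"
    by (auto dest!: code_at_append simp: add.assoc)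
  from Sub.IH(1)[OF c(1) Sub.prems(2-)] obtain s1 where
    s1: "reach P (poly (time_poly a) N) s s1" "pc s1 = p + code_length a"
      "regs s1 d = eval (mem s) N (regs s \<circ> vs) a" "\<forall>r<d. regs s1 r = regs s r"
      "mem s1 = mem s" by blast
  have vs: "regs s1 \<circ> vs = regs s \<circ> vs" using s1(4) Sub.prems(3) by auto
  have "\<exists>s'. reach P (poly (time_poly b) N) s1 s' \<and> pc s' = p + code_length a + code_length b \<and>
      regs s' (d + 1) = eval (mem s1) N (regs s1 \<circ> vs) b \<and>
      (\<forall>r<d + 1. regs s' r = regs s1 r) \<and> mem s' = mem s1"
    by (rule Sub.IH(2)[OF c(2) s1(2)]) (use Sub.prems(3-) s1(4) in \<open>auto intro: less_SucI\<close>)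
  then obtain s2 where
    s2: "reach P (poly (time_poly b) N) s1 s2" "pc s2 = p + code_length a + code_length b"
      "regs s2 (d + 1) = eval (mem s1) N (regs s1 \<circ> vs) b" "\<forall>r<d + 1. regs s2 r = regs s1 r"
      "mem s2 = mem s1" by blast
  let ?s3 = "exec_instr (Minus d d (d + 1)) s2"
  have "reach P 1 s2 ?s3"
    using code_at_Cons[OF c(3)] s2(2) by (intro reach_instr) auto
  from reach_trans[OF reach_trans[OF s1(1) s2(1)] this]
  show ?case using s1 s2 vs by (intro exI[of _ ?s3]) (auto simp: poly_add comp_def)
next
  case (Ld a)
  then have c: "code_at P p (compile vs d p a)" "code_at P (p + code_length a) [Load d d]"
    by (auto dest!: code_at_append)
  from Ld.IH[OF c(1) Ld.prems(2-)] obtain s1 where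
    s1: "reach P (poly (time_poly a) N) s s1" "pc s1 = p + code_length a"
      "regs s1 d = eval (mem s) N (regs s \<circ> vs) a" "\<forall>r<d. regs s1 r = regs s r"
      "mem s1 = mem s" by blast
  let ?s2 = "exec_instr (Load d d) s1"
  have "reach P 1 s1 ?s2"
    using code_at_Cons[OF c(2)] s1(2) by (intro reach_instr) auto
  from reach_trans[OF s1(1) this]
  show ?case using s1 by (intro exI[of _ ?s2]) (auto simp: poly_add comp_def)
next
  case (Sum a)
  \<comment> \<open>Register \<open>d\<close> accumulates the sum, \<open>d + 1\<close> counts down
    from \<open>N\<close>, \<open>d + 2\<close> holds 1 and \<open>d + 3\<close> receives the value
    of the body. The loop test is at \<open>p + 3\<close>.\<close>
  let ?l = "code_length a"
  let ?vs = "case_nat (d + 1) vs"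
  let ?pre = "[Const d 0, Plus (d + 1) d 0, Const (d + 2) 1,
      JumpZero (d + 1) (p + ?l + 7), Minus (d + 1) (d + 1) (d + 2)]"
  let ?body = "compile ?vs (d + 3) (p + 5) a"
  let ?post = "[Plus d d (d + 3), Jump (p + 3)]"
  have len: "length ?pre = 5" by simp
  note c0 = code_at_append[OF Sum.prems(1)[unfolded compile.simps], unfolded len]
  have c1: "code_at P p ?pre" using c0 ..
  have c2: "code_at P (p + 5) ?body" and c3: "code_at P (p + 5 + ?l) ?post"
    using code_at_append[OF c0[THEN conjunct2]] by (simp_all only: length_compile)
  have P0: "p < length P" "P ! p = Const d 0"
    and P1: "Suc p < length P" "P ! Suc p = Plus (d + 1) d 0"
    and P2: "Suc (Suc p) < length P" "P ! Suc (Suc p) = Const (d + 2) 1"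
    and P3: "p + 3 < length P" "P ! (p + 3) = JumpZero (d + 1) (p + ?l + 7)"
    and P4: "p + 4 < length P" "P ! (p + 4) = Minus (d + 1) (d + 1) (d + 2)"
    using code_at_nth[OF c1, of 0] code_at_nth[OF c1, of "Suc 0"]
      code_at_nth[OF c1, of "Suc (Suc 0)"] code_at_nth[OF c1, of 3] code_at_nth[OF c1, of 4]
    by simp_all
  have P5: "p + 5 + ?l < length P" "P ! (p + 5 + ?l) = Plus d d (d + 3)"
    and P6: "p + 6 + ?l < length P" "P ! (p + 6 + ?l) = Jump (p + 3)"
    using code_at_nth[OF c3, of 0] code_at_nth[OF c3, of 1] by (simp_all add: numeral_eq_Suc)
  let ?f = "\<lambda>i. eval (mem s) N (case_nat i (regs s \<circ> vs)) a"
  let ?T = "poly (time_poly a) N + 4"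
  \<comment> \<open>Loop invariant with \<open>m\<close> rounds left: the indices run downwards, so
    those still to come are exactly the \<open>i < m\<close>.\<close>
  have loop: "\<exists>s'. reach P (1 + m * ?T) s1 s' \<and> pc s' = p + code_length (Sum a) \<and>
      regs s' d = acc + (\<Sum>i<m. ?f i) \<and> (\<forall>r<d. regs s' r = regs s r) \<and> mem s' = mem s"
    if "pc s1 = p + 3" "regs s1 d = acc" "regs s1 (d + 1) = m" "regs s1 (d + 2) = 1"
      "\<forall>r<d. regs s1 r = regs s r" "mem s1 = mem s" for m acc s1
    using that
  proof (induction m arbitrary: acc s1)
    case 0
    then show ?case
      using reach_instr[OF P3, of s1] by (intro exI[of _ "s1\<lparr>pc := p + ?l + 7\<rparr>"]) auto
  next
    case (Suc m)
    let ?s2 = "exec_instr (JumpZero (d + 1) (p + ?l + 7)) s1"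
    let ?s3 = "exec_instr (Minus (d + 1) (d + 1) (d + 2)) ?s2"
    have pc3: "pc ?s3 = p + 5" using Suc.prems by simp
    have r3: "reach P 2 s1 ?s3"
      using reach_trans[OF reach_instr[OF P3, of s1] reach_instr[OF P4, of ?s2]] Suc.prems
      by (simp add: numeral_2_eq_2)
    \<comment> \<open>The decremented counter doubles as the register of the bound variable, whose
      value in this round is \<open>m\<close>.\<close>
    have env: "regs ?s3 \<circ> ?vs = case_nat m (regs s \<circ> vs)"
    proof
      fix x
      show "(regs ?s3 \<circ> ?vs) x = case_nat m (regs s \<circ> vs) x"
      proof (cases x)
        case y: (Suc y)
        show ?thesis using Suc.prems(5) Sum.prems(3)[of y] by (simp add: y)
      qed (use Suc.prems in simp)
    qed
    have "\<exists>s'. reach P (poly (time_poly a) N) ?s3 s' \<and> pc s' = p + 5 + ?l \<and>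
        regs s' (d + 3) = eval (mem ?s3) N (regs ?s3 \<circ> ?vs) a \<and>
        (\<forall>r<d + 3. regs s' r = regs ?s3 r) \<and> mem s' = mem ?s3"
    proof (rule Sum.IH[OF c2 pc3])
      show "?vs x < d + 3" for x
        using Sum.prems(3) by (auto split: nat.split intro: trans_less_add1)
      show "regs ?s3 0 = N" using Suc.prems Sum.prems by auto
    qed simp
    then obtain s4 where s4: "reach P (poly (time_poly a) N) ?s3 s4" "pc s4 = p + 5 + ?l"
        "regs s4 (d + 3) = ?f m"
        "\<forall>r<d + 3. regs s4 r = regs ?s3 r" "mem s4 = mem s"
      unfolding env using Suc.prems(6) by auto
    let ?s5 = "exec_instr (Plus d d (d + 3)) s4"
    let ?s6 = "exec_instr (Jump (p + 3)) ?s5"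
    have r6: "reach P 2 s4 ?s6"
      using reach_trans[OF reach_instr[OF P5, of s4] reach_instr[OF P6, of ?s5]] s4(2)
      by (simp add: numeral_2_eq_2)
    have "\<exists>s'. reach P (1 + m * ?T) ?s6 s' \<and> pc s' = p + code_length (Sum a) \<and>
        regs s' d = (acc + ?f m) + (\<Sum>i<m. ?f i) \<and> (\<forall>r<d. regs s' r = regs s r) \<and> mem s' = mem s"
      by (rule Suc.IH) (use s4 Suc.prems in auto)
    then obtain s' where s': "reach P (1 + m * ?T) ?s6 s'" "pc s' = p + code_length (Sum a)"
        "regs s' d = (acc + ?f m) + (\<Sum>i<m. ?f i)" "\<forall>r<d. regs s' r = regs s r" "mem s' = mem s"
      by blast
    have "reach P (1 + Suc m * ?T) s1 s'"
      by (rule reach_mono[OF reach_trans[OF reach_trans[OF reach_trans[OF r3 s4(1)] r6] s'(1)]]) simp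
    then show ?case using s' by (intro exI[of _ s']) auto
  qed
  let ?t1 = "exec_instr (Const d 0) s"
  let ?t2 = "exec_instr (Plus (d + 1) d 0) ?t1"
  let ?t3 = "exec_instr (Const (d + 2) 1) ?t2"
  have r: "reach P 3 s ?t3"
    using reach_trans[OF reach_trans[OF reach_instr[OF P0 \<open>pc s = p\<close>] reach_instr[OF P1, of ?t1]]
      reach_instr[OF P2, of ?t2]] Sum.prems by (simp add: numeral_3_eq_3)
  have "\<exists>s'. reach P (1 + N * ?T) ?t3 s' \<and> pc s' = p + code_length (Sum a) \<and>
      regs s' d = 0 + (\<Sum>i<N. ?f i) \<and> (\<forall>r<d. regs s' r = regs s r) \<and> mem s' = mem s"
    by (rule loop) (use Sum.prems in auto)
  then obtain s' where s': "reach P (1 + N * ?T) ?t3 s'" "pc s' = p + code_length (Sum a)"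
      "regs s' d = 0 + (\<Sum>i<N. ?f i)" "\<forall>r<d. regs s' r = regs s r" "mem s' = mem s"
    by blast
  have "reach P (poly (time_poly (Sum a)) N) s s'"
    by (rule reach_mono[OF reach_trans[OF r s'(1)]]) (simp add: poly_add poly_mult)
  then show ?case using s' by (intro exI[of _ s']) (auto simp: comp_def)
qed

section \<open>From terms to polynomial-time decision procedures\<close>

lemma ram_run_halted: "halted P s \<Longrightarrow> ram_run P t s = s"
  by (induction t) (auto simp: ram_run_def ram_step_def)

lemma reach_halted:
  assumes "reach P T s s'" "halted P s'"
  shows "ram_run P T s = s'"
proof -
  obtain t where t: "t \<le> T" "ram_run P t s = s'" using assms(1) by (auto simp: reach_def)
  have "ram_run P T s = ram_run P (T - t) (ram_run P t s)"
    using t(1) unfolding ram_run_def by (metis comp_apply funpow_add le_add_diff_inverse2)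
  then show ?thesis using t(2) ram_run_halted[OF assms(2)] by simp
qed

definition bits_mem :: "bool list \<Rightarrow> nat \<Rightarrow> nat" where
  "bits_mem x = (\<lambda>i. if i < length x then of_bool (x ! i) else 0)"

text \<open>All free variables are assigned to register 0, which initially holds the input length;
  hence the constant environment.\<close>

lemma poly_time_solvable_on_term:
  assumes "\<And>x. x \<in> D \<Longrightarrow>
    eval (bits_mem (enc x)) (length (enc x)) (\<lambda>_. length (enc x)) t = of_bool (Q x)"
  shows "poly_time_solvable_on enc D Q"
proof -
  let ?c = "compile (\<lambda>_. 0) 1 0 t"
  \<comment> \<open>The value of \<open>t\<close> is left in register 1 and is moved to the output
    register 0 by the two final instructions.\<close>
  let ?P = "?c @ [Const 0 0, Plus 0 0 1]"
  let ?l = "code_length t"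
  have "halted ?P s \<and> regs s 0 = of_bool (Q x)"
    if x: "x \<in> D" and s: "s = ram_run ?P (poly (time_poly t + 2) (length (enc x))) (ram_init (enc x))"
    for x s
  proof -
    let ?N = "length (enc x)" and ?i = "ram_init (enc x)"
    have "\<exists>s'. reach ?P (poly (time_poly t) ?N) ?i s' \<and> pc s' = 0 + ?l \<and>
        regs s' 1 = eval (mem ?i) ?N (regs ?i \<circ> (\<lambda>_. 0)) t \<and>
        (\<forall>r<1. regs s' r = regs ?i r) \<and> mem s' = mem ?i"
      by (rule compile_correct) (auto simp: code_at_def ram_init_def)
    then obtain s1 where s1: "reach ?P (poly (time_poly t) ?N) ?i s1" "pc s1 = ?l"
        "regs s1 1 = of_bool (Q x)"
      using assms[OF x] by (auto simp: ram_init_def bits_mem_def comp_def)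
    let ?s2 = "exec_instr (Const 0 0) s1"
    let ?s3 = "exec_instr (Plus 0 0 1) ?s2"
    have "reach ?P 1 s1 ?s2" "reach ?P 1 ?s2 ?s3"
      using s1(2) by (intro reach_instr[OF _ _ refl]; simp add: nth_append)+
    from reach_trans[OF reach_trans[OF s1(1) this(1)] this(2)]
    have "reach ?P (poly (time_poly t + 2) ?N) ?i ?s3" by (simp add: poly_add add.assoc)
    moreover have "halted ?P ?s3" using s1(2) by (simp add: halted_def)
    ultimately have "s = ?s3" using s reach_halted by blast
    then show ?thesis using s1 \<open>halted ?P ?s3\<close> by simp
  qed
  then show ?thesis
    unfolding poly_time_solvable_on_def Let_def by blast
qed

section \<open>Logical connectives and the input encoding as terms\<close>

text \<open>As truth values, all positive numbers count as true.\<close>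

definition Neg :: "tm \<Rightarrow> tm" where "Neg a = Sub (Cst 1) a"
definition Disj :: "tm \<Rightarrow> tm \<Rightarrow> tm" where "Disj a b = Neg (Neg (Add a b))"
definition Conj :: "tm \<Rightarrow> tm \<Rightarrow> tm" where "Conj a b = Neg (Disj (Neg a) (Neg b))"
definition Lt :: "tm \<Rightarrow> tm \<Rightarrow> tm" where "Lt a b = Neg (Neg (Sub b a))"
definition All :: "tm \<Rightarrow> tm" where "All a = Neg (Sum (Neg a))"

fun Conjs :: "nat \<Rightarrow> (nat \<Rightarrow> tm) \<Rightarrow> tm" where
  "Conjs 0 f = Cst 1"
| "Conjs (Suc k) f = Conj (Conjs k f) (f k)"

fun Disjs :: "nat \<Rightarrow> (nat \<Rightarrow> tm) \<Rightarrow> tm" where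
  "Disjs 0 f = Cst 0"
| "Disjs (Suc k) f = Disj (Disjs k f) (f k)"

lemma eval_Neg [simp]: "eval M N \<rho> (Neg a) = of_bool (\<not> 0 < eval M N \<rho> a)"
  by (auto simp: Neg_def)

lemma eval_Disj [simp]: "eval M N \<rho> (Disj a b) = of_bool (0 < eval M N \<rho> a \<or> 0 < eval M N \<rho> b)"
  by (auto simp: Disj_def)

lemma eval_Conj [simp]: "eval M N \<rho> (Conj a b) = of_bool (0 < eval M N \<rho> a \<and> 0 < eval M N \<rho> b)"
  by (auto simp: Conj_def)

lemma eval_Lt [simp]: "eval M N \<rho> (Lt a b) = of_bool (eval M N \<rho> a < eval M N \<rho> b)"
  by (auto simp: Lt_def)

text \<open>A sum of natural numbers is positive iff some summand is, so \<open>Sum\<close> serves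
  as bounded existential quantifier.\<close>

lemma eval_Sum_pos: "0 < eval M N \<rho> (Sum a) \<longleftrightarrow> (\<exists>i<N. 0 < eval M N (case_nat i \<rho>) a)"
  by (auto simp: sum_nonneg_eq_0_iff zero_less_iff_neq_zero simp del: neq0_conv)

lemma eval_All [simp]: "eval M N \<rho> (All a) = of_bool (\<forall>i<N. 0 < eval M N (case_nat i \<rho>) a)"
  unfolding All_def eval_Neg eval_Sum_pos by auto

lemma eval_Conjs [simp]: "0 < eval M N \<rho> (Conjs k f) \<longleftrightarrow> (\<forall>j<k. 0 < eval M N \<rho> (f j))"
  by (induction k) (auto simp: less_Suc_eq)

lemma eval_Disjs [simp]: "0 < eval M N \<rho> (Disjs k f) \<longleftrightarrow> (\<exists>j<k. 0 < eval M N \<rho> (f j))"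
  by (induction k) (auto simp: less_Suc_eq)

fun Exs :: "nat \<Rightarrow> tm \<Rightarrow> tm" where
  "Exs 0 a = a"
| "Exs (Suc k) a = Sum (Exs k a)"

lemma eval_Exs_pos:
  "0 < eval M N \<rho> (Exs k a) \<longleftrightarrow>
     (\<exists>\<rho>'. (\<forall>x<k. \<rho>' x < N) \<and> (\<forall>x. \<rho>' (k + x) = \<rho> x) \<and> 0 < eval M N \<rho>' a)"
proof (induction k arbitrary: \<rho>)
  case 0
  have "\<rho>' = \<rho>" if "\<forall>x. \<rho>' x = \<rho> x" for \<rho>' using that by auto
  then show ?case by auto
next
  case (Suc k)
  \<comment> \<open>The outermost sum binds first and the \<open>k\<close> inner ones push their
    values in front, so its value \<open>i\<close> ends up as variable \<open>k\<close>.\<close>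
  have eq: "(\<exists>i<N. (\<forall>x<k. \<rho>' x < N) \<and> (\<forall>x. \<rho>' (k + x) = case_nat i \<rho> x)) \<longleftrightarrow>
    (\<forall>x<Suc k. \<rho>' x < N) \<and> (\<forall>x. \<rho>' (Suc k + x) = \<rho> x)" (is "?L \<longleftrightarrow> ?R") for \<rho>'
  proof
    assume ?L
    then obtain i where i: "i < N" "\<forall>x<k. \<rho>' x < N" "\<And>x. \<rho>' (k + x) = case_nat i \<rho> x" by blast
    from i(3)[of 0] i(3)[of "Suc _"] show ?R using i(1,2) by (auto simp: less_Suc_eq)
  next
    assume ?R
    then show ?L by (intro exI[of _ "\<rho>' k"]) (auto split: nat.split)
  qed
  have "0 < eval M N \<rho> (Exs (Suc k) a) \<longleftrightarrow>
      (\<exists>\<rho>'. (\<exists>i<N. (\<forall>x<k. \<rho>' x < N) \<and> (\<forall>x. \<rho>' (k + x) = case_nat i \<rho> x)) \<and> 0 < eval M N \<rho>' a)"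
    unfolding Exs.simps eval_Sum_pos Suc.IH by blast
  then show ?case unfolding eq by blast
qed

text \<open>The length of the initial block of ones in the memory, i.e. the number of vertices.\<close>

definition Num :: tm where
  "Num = Sum (All (Disj (Lt (Var (Suc 0)) (Var 0)) (Ld (Var 0))))"

text \<open>Multiplication by counting pairs, correct for factors up to \<open>N\<close>. Both
  factors are evaluated below two binders, so their free variables must be shifted by 2.\<close>

definition Prod :: "tm \<Rightarrow> tm \<Rightarrow> tm" where
  "Prod a b = Sum (Sum (Conj (Lt (Var (Suc 0)) a) (Lt (Var 0) b)))"

fun Scale :: "nat \<Rightarrow> tm \<Rightarrow> tm" where
  "Scale 0 a = Cst 0"
| "Scale (Suc k) a = Add a (Scale k a)"

text \<open>The matrix starts at address \<open>n + 1\<close>, after the unary block and the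
  separator. The row index is shifted because it is used inside \<open>Prod\<close>;
  \<open>Num\<close> is closed.\<close>

definition Adj :: "nat \<Rightarrow> nat \<Rightarrow> tm" where
  "Adj x y = Ld (Add (Add Num (Cst 1)) (Add (Prod (Var (Suc (Suc x))) Num) (Var y)))"

definition In_list :: "nat \<Rightarrow> nat \<Rightarrow> nat \<Rightarrow> tm" where
  "In_list k j x =
     Ld (Add (Add Num (Cst 1)) (Add (Prod Num Num) (Add (Scale k (Var x)) (Cst j))))"

lemma eval_Scale [simp]: "eval M N \<rho> (Scale k a) = eval M N \<rho> a * k"
  by (induction k) auto

lemma sum_of_bool_less: "a \<le> N \<Longrightarrow> (\<Sum>i<N. of_bool (i < a)) = (a :: nat)"
proof -
  assume "a \<le> N"
  then have "{i. i < N \<and> i < a} = {..<a}" by auto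
  then show ?thesis by (simp add: of_bool_def sum.If_cases Int_def lessThan_def)
qed

lemma sum_of_bool_less2:
  assumes "a \<le> N" "b \<le> N"
  shows "(\<Sum>i<N. \<Sum>j<N. of_bool (i < a \<and> j < b)) = a * (b :: nat)"
proof -
  have "(\<Sum>i<N. \<Sum>j<N. of_bool (i < a \<and> j < b)) =
      (\<Sum>i<N. of_bool (i < a)) * (\<Sum>j<N. of_bool (j < b) :: nat)"
    by (simp only: sum_product of_bool_conj)
  then show ?thesis using assms by (simp only: sum_of_bool_less less_imp_le)
qed

text \<open>An index is counted iff no zero occurs up to and including it, which singles out the
  indices before the first zero, at \<open>n\<close>.\<close>

lemma eval_Num:
  assumes "n < N" "\<And>j. j < n \<Longrightarrow> 0 < M j" "M n = 0"
  shows "eval M N \<rho> Num = n"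
proof -
  have iff: "(\<forall>j<N. i < j \<or> 0 < M j) \<longleftrightarrow> i < n" if "i < N" for i
    using assms that by (metis le_less_trans less_irrefl not_less)
  have "eval M N (case_nat i \<rho>) (All (Disj (Lt (Var (Suc 0)) (Var 0)) (Ld (Var 0)))) =
      of_bool (\<forall>j<N. i < j \<or> 0 < M j)" for i
    by simp
  then have "eval M N \<rho> Num = (\<Sum>i<N. of_bool (i < n))"
    unfolding Num_def eval.simps(6) by (intro sum.cong refl) (simp only: iff lessThan_iff)
  then show ?thesis using assms by (simp only: sum_of_bool_less less_imp_le)
qed

text \<open>The layout of the input as seen by the terms. By \<open>n < N\<close>, quantified
  variables range over all vertices and also over the non-vertex \<open>n\<close>.\<close>

locale encoded_structure =
  fixes M :: "nat \<Rightarrow> nat" and N n k :: nat and E :: "nat \<Rightarrow> nat \<Rightarrow> bool" and S :: "nat \<Rightarrow> nat \<Rightarrow> bool"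
  assumes n_less: "n < N"
    and ones: "\<And>j. j < n \<Longrightarrow> M j = 1" "M n = 0"
    and adj: "\<And>u v. u < n \<Longrightarrow> v < n \<Longrightarrow> M (n + 1 + (u * n + v)) = of_bool (E u v)"
    and lists: "\<And>v j. v < n \<Longrightarrow> j < k \<Longrightarrow> M (n + 1 + (n * n + (v * k + j))) = of_bool (S v j)"
begin

lemma eval_Num' [simp]: "eval M N \<rho> Num = n"
  by (rule eval_Num) (use n_less ones in auto)

lemma eval_Adj [simp]:
  assumes "\<rho> x < n" "\<rho> y < n"
  shows "eval M N \<rho> (Adj x y) = of_bool (E (\<rho> x) (\<rho> y))"
  using adj[OF assms] assms n_less sum_of_bool_less2[of "\<rho> x" N n]
  by (simp add: Adj_def Prod_def)

lemma eval_In_list [simp]: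
  assumes "\<rho> x < n" "j < k"
  shows "eval M N \<rho> (In_list k j x) = of_bool (S (\<rho> x) j)"
  using lists[OF assms] assms n_less sum_of_bool_less2[of n N n]
  by (simp add: In_list_def Prod_def)

end

section \<open>The term expressing the existence of representatives\<close>

text \<open>
  \<open>B a j\<close> states that the vertices number \<open>a\<close> and \<open>j\<close> of \<open>H\<close> are adjacent. The representative of
  vertex \<open>j\<close> is the variable \<open>d + j\<close>.
\<close>

definition Candidate :: "nat \<Rightarrow> (nat \<Rightarrow> nat \<Rightarrow> bool) \<Rightarrow> nat \<Rightarrow> nat \<Rightarrow> nat \<Rightarrow> tm" where
  "Candidate k B d a x = Conj (In_list k a x)
     (Conjs k (\<lambda>j. Disj (Neg (Lt (Var (d + j)) Num))
        (if B a j then Adj x (d + j) else Neg (Adj x (d + j)))))"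

text \<open>Variable 0 is the quantified vertex, so the representatives start at 1. Quantifiers
  range up to \<open>N\<close>; comparison with \<open>Num\<close> relativises them to
  vertices.\<close>

definition Covered :: "nat \<Rightarrow> (nat \<Rightarrow> nat \<Rightarrow> bool) \<Rightarrow> tm" where
  "Covered k B = All (Disj (Neg (Lt (Var 0) Num))
     (Disjs k (\<lambda>a. Conj (Lt (Var (1 + a)) Num) (Candidate k B 1 a 0))))"

text \<open>Two quantified vertices precede the representatives, hence the offset 2. Adjacency in
  \<open>H\<close> is known when the term is built and enters as a constant.\<close>

definition Compatible :: "nat \<Rightarrow> (nat \<Rightarrow> nat \<Rightarrow> bool) \<Rightarrow> tm" where
  "Compatible k B = All (All
     (Disj (Neg (Conj (Conj (Lt (Var 1) Num) (Lt (Var 0) Num)) (Adj 1 0)))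
       (Conjs k (\<lambda>a. Conjs k (\<lambda>b. Disj (Cst (of_bool (B a b)))
           (Neg (Conj (Conj (Lt (Var (2 + a)) Num) (Lt (Var (2 + b)) Num))
                      (Conj (Candidate k B 2 a 1) (Candidate k B 2 b 0)))))))))"

text \<open>The double negation turns the number of witnesses into a truth value 0 or 1.\<close>

definition Representatives :: "nat \<Rightarrow> (nat \<Rightarrow> nat \<Rightarrow> bool) \<Rightarrow> tm" where
  "Representatives k B = Neg (Neg (Exs k (Conj (Covered k B) (Compatible k B))))"

section \<open>Semantics of the terms on an encoded input\<close>

context encoded_structure
begin

text \<open>Counterpart of \<open>candidate\<close> with vertices of \<open>H\<close> replaced by
  their numbers; \<open>covered\<close> and \<open>compatible\<close> are likewise the two parts of
  \<open>representatives\<close>.\<close>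

definition cand :: "(nat \<Rightarrow> nat \<Rightarrow> bool) \<Rightarrow> (nat \<Rightarrow> nat) \<Rightarrow> nat \<Rightarrow> nat \<Rightarrow> bool" where
  "cand B r a u \<longleftrightarrow> S u a \<and> (\<forall>j<k. r j < n \<longrightarrow> (B a j \<longleftrightarrow> E u (r j)))"

definition covered :: "(nat \<Rightarrow> nat \<Rightarrow> bool) \<Rightarrow> (nat \<Rightarrow> nat) \<Rightarrow> bool" where
  "covered B r \<longleftrightarrow> (\<forall>u<n. \<exists>a<k. r a < n \<and> cand B r a u)"

definition compatible :: "(nat \<Rightarrow> nat \<Rightarrow> bool) \<Rightarrow> (nat \<Rightarrow> nat) \<Rightarrow> bool" where
  "compatible B r \<longleftrightarrow> (\<forall>u<n. \<forall>v<n. E u v \<longrightarrow>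
     (\<forall>a<k. \<forall>b<k. \<not> B a b \<longrightarrow> \<not> (r a < n \<and> r b < n \<and> cand B r a u \<and> cand B r b v)))"

lemma eval_Candidate [simp]:
  assumes "\<rho> x < n" "a < k"
  shows "0 < eval M N \<rho> (Candidate k B d a x) \<longleftrightarrow> cand B (\<lambda>j. \<rho> (d + j)) a (\<rho> x)"
proof -
  have "0 < eval M N \<rho> (Disj (Neg (Lt (Var (d + j)) Num))
        (if B a j then Adj x (d + j) else Neg (Adj x (d + j)))) \<longleftrightarrow>
      (\<rho> (d + j) < n \<longrightarrow> (B a j \<longleftrightarrow> E (\<rho> x) (\<rho> (d + j))))" for j
    \<comment> \<open>For a value of at least \<open>n\<close> the content read by
      \<open>Adj\<close> is unknown, but then the first disjunct is true.\<close>
    using assms by (cases "\<rho> (d + j) < n") auto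
  then show ?thesis using assms by (simp add: Candidate_def cand_def)
qed

lemma eval_Covered [simp]: "0 < eval M N r (Covered k B) \<longleftrightarrow> covered B r"
proof -
  have "0 < eval M N (case_nat u r) (Disj (Neg (Lt (Var 0) Num))
     (Disjs k (\<lambda>a. Conj (Lt (Var (1 + a)) Num) (Candidate k B 1 a 0)))) \<longleftrightarrow>
     (u < n \<longrightarrow> (\<exists>a<k. r a < n \<and> cand B r a u))" for u
    by (cases "u < n") auto
  then have "0 < eval M N r (Covered k B) \<longleftrightarrow>
      (\<forall>u<N. u < n \<longrightarrow> (\<exists>a<k. r a < n \<and> cand B r a u))"
    unfolding Covered_def eval_All zero_less_of_bool_iff by simp
  then show ?thesis unfolding covered_def using n_less by (meson less_trans)
qed

lemma eval_Compatible [simp]: "0 < eval M N r (Compatible k B) \<longleftrightarrow> compatible B r"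
proof -
  let ?C = "\<lambda>u v. E u v \<longrightarrow>
     (\<forall>a<k. \<forall>b<k. \<not> B a b \<longrightarrow> \<not> (r a < n \<and> r b < n \<and> cand B r a u \<and> cand B r b v))"
  have "0 < eval M N (case_nat v (case_nat u r))
       (Disj (Neg (Conj (Conj (Lt (Var 1) Num) (Lt (Var 0) Num)) (Adj 1 0)))
       (Conjs k (\<lambda>a. Conjs k (\<lambda>b. Disj (Cst (of_bool (B a b)))
           (Neg (Conj (Conj (Lt (Var (2 + a)) Num) (Lt (Var (2 + b)) Num))
                      (Conj (Candidate k B 2 a 1) (Candidate k B 2 b 0)))))))) \<longleftrightarrow>
     (u < n \<longrightarrow> v < n \<longrightarrow> ?C u v)" for u v
    by (cases "u < n \<and> v < n") (auto simp: numeral_2_eq_2)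
  then have "0 < eval M N r (Compatible k B) \<longleftrightarrow> (\<forall>u<N. \<forall>v<N. u < n \<longrightarrow> v < n \<longrightarrow> ?C u v)"
    unfolding Compatible_def eval_All zero_less_of_bool_iff by simp
  then show ?thesis unfolding compatible_def using n_less by (meson less_trans)
qed

text \<open>Only the first \<open>k\<close> values of \<open>r\<close> matter, so the remaining ones
  can be set to the shifted environment \<open>\<rho>\<close>, as \<open>eval_Exs_pos\<close>
  demands.\<close>

lemma eval_Representatives:
  "eval M N \<rho> (Representatives k B) =
     of_bool (\<exists>r. (\<forall>j<k. r j < N) \<and> covered B r \<and> compatible B r)"
proof -
  have cong: "covered B r = covered B r'" "compatible B r = compatible B r'"
    if "\<And>j. j < k \<Longrightarrow> r j = r' j" for r r'
  proof -
    have "cand B r = cand B r'" using that by (auto simp: cand_def fun_eq_iff)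
    then show "covered B r = covered B r'" "compatible B r = compatible B r'"
      using that by (simp_all add: covered_def compatible_def cong: conj_cong)
  qed
  have "(\<exists>r. (\<forall>j<k. r j < N) \<and> (\<forall>x. r (k + x) = \<rho> x) \<and> covered B r \<and> compatible B r) \<longleftrightarrow>
      (\<exists>r. (\<forall>j<k. r j < N) \<and> covered B r \<and> compatible B r)"
  proof
    assume "\<exists>r. (\<forall>j<k. r j < N) \<and> covered B r \<and> compatible B r"
    then obtain r where r: "\<forall>j<k. r j < N" "covered B r" "compatible B r" by blast
    let ?r = "\<lambda>j. if j < k then r j else \<rho> (j - k)"
    have "covered B ?r" "compatible B ?r" using r(2,3) cong[of ?r r] by simp_all
    with r(1) show "\<exists>r. (\<forall>j<k. r j < N) \<and> (\<forall>x. r (k + x) = \<rho> x) \<and> covered B r \<and> compatible B r"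
      by (intro exI[of _ ?r]) auto
  qed blast
  then show ?thesis by (simp add: Representatives_def eval_Exs_pos)
qed

end

section \<open>Decoding the input string\<close>

lemma length_concat_map_map:
  "length (concat (map (\<lambda>u. map (f u) ys) xs)) = length xs * length ys"
  by (induction xs) auto

lemma nth_concat_map_map:
  "i < length xs \<Longrightarrow> j < length ys \<Longrightarrow>
     concat (map (\<lambda>u. map (f u) ys) xs) ! (i * length ys + j) = f (xs ! i) (ys ! j)"
proof (induction xs arbitrary: i)
  case (Cons x xs)
  then show ?case by (cases i) (auto simp: nth_append)
qed simp

lemma encoded_structure_lhom_encode:
  assumes "card (pverts G) = n"
  shows "encoded_structure (bits_mem (lhom_encode hs (G, L))) (length (lhom_encode hs (G, L)))
           n (length hs) (\<lambda>u v. (u, v) \<in> parcs G) (\<lambda>v j. hs ! j \<in> L v)"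
proof -
  let ?k = "length hs"
  let ?A = "concat (map (\<lambda>u. map (\<lambda>v. (u, v) \<in> parcs G) [0..<n]) [0..<n])"
  let ?B = "concat (map (\<lambda>v. map (\<lambda>h. h \<in> L v) hs) [0..<n])"
  define x where "x = lhom_encode hs (G, L)"
  have x: "x = replicate n True @ [False] @ ?A @ ?B"
    using assms by (simp add: x_def lhom_encode_def Let_def)
  have A: "length ?A = n * n" and B: "length ?B = n * ?k"
    by (simp_all add: length_concat_map_map)
  have len: "length x = n + 1 + (n * n + n * ?k)"
    unfolding x by (simp only: length_append A B) simp
  have bound: "u * m + v < n * m" if "u < n" "v < m" for u v m :: nat
  proof -
    have "u * m + v < Suc u * m" using that by simp
    also have "\<dots> \<le> n * m" using that by (intro mult_le_mono1) simp
    finally show ?thesis .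
  qed
  have xA: "x ! (n + 1 + i) = ?A ! i" if "i < n * n" for i
    using that A unfolding x by (simp add: nth_append)
  have xB: "x ! (n + 1 + (n * n + i)) = ?B ! i" for i
    using A unfolding x by (simp add: nth_append)
  have "encoded_structure (bits_mem x) (length x)
           n ?k (\<lambda>u v. (u, v) \<in> parcs G) (\<lambda>v j. hs ! j \<in> L v)"
  proof
    show "n < length x" by (simp add: len)
    show "bits_mem x j = 1" if "j < n" for j
      using that len by (simp add: bits_mem_def) (simp add: x nth_append)
    show "bits_mem x n = 0"
      by (simp add: bits_mem_def) (simp add: x nth_append)
    show "bits_mem x (n + 1 + (u * n + v)) = of_bool ((u, v) \<in> parcs G)" if "u < n" "v < n" for u v
      using nth_concat_map_map[of u "[0..<n]" v "[0..<n]" "\<lambda>u v. (u, v) \<in> parcs G"]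
        bound[OF that] xA[of "u * n + v"] that len
      by (simp add: bits_mem_def)
    show "bits_mem x (n + 1 + (n * n + (v * ?k + j))) = of_bool (hs ! j \<in> L v)"
      if "v < n" "j < ?k" for v j
      using nth_concat_map_map[of v "[0..<n]" j hs "\<lambda>v h. h \<in> L v"]
        bound[OF that] xB[of "v * ?k + j"] that len
      by (simp add: bits_mem_def)
  qed
  then show ?thesis by (simp add: x_def)
qed

text \<open>Replaces maps on the vertices of \<open>H\<close> by maps on list positions with values
  below \<open>N\<close>, which are what \<open>length hs\<close> nested loops enumerate.\<close>

lemma lhom_yes_iff_representatives:
  assumes "pair_graph H" "triangle_free H" "distinct hs" "set hs = pverts H"
    and "pair_graph G" "pverts G = {..<n}" "graph_diameter G \<le> 2" "n < N"
  shows "lhom_yes H (G, L) \<longleftrightarrow>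
    (\<exists>r. (\<forall>j<length hs. r j < N) \<and> representatives G H L (r \<circ> the_inv_into {..<length hs} ((!) hs)))"
proof
  let ?k = "length hs"
  let ?idx = "the_inv_into {..<?k} ((!) hs)"
  have inj: "inj_on ((!) hs) {..<?k}" using assms(3) by (simp add: inj_on_nth)
  assume "lhom_yes H (G, L)"
  then obtain \<phi> where "list_homomorphism G H L \<phi>" by (auto simp: lhom_yes_def)
  \<comment> \<open>The default for vertices outside the image is \<open>n\<close>, the least number
    that is not a vertex; it is still below \<open>N\<close>.\<close>
  from homomorphism_imp_representatives[OF assms(5,1,2,7) this, of n] assms(6)
  obtain r where r: "\<forall>h. r h \<in> insert n {..<n}" "representatives G H L r" by auto
  let ?r = "\<lambda>j. r (hs ! j)"
  have eq: "(?r \<circ> ?idx) h = r h" if "h \<in> pverts H" for h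
  proof -
    have "h \<in> set hs" using that assms(4) by simp
    then obtain j where j: "j < ?k" and h: "h = hs ! j" unfolding in_set_conv_nth by blast
    show ?thesis unfolding h using j by (simp add: the_inv_into_f_f[OF inj])
  qed
  then have "candidate G H L (?r \<circ> ?idx) = candidate G H L r"
    by (auto simp: candidate_def fun_eq_iff)
  then have "representatives G H L (?r \<circ> ?idx)"
    using r(2) eq unfolding representatives_def by (simp cong: bex_cong ball_cong)
  moreover have "\<forall>j<?k. ?r j < N" using r(1) assms(8) by (metis insert_iff lessThan_iff less_trans)
  ultimately show "\<exists>r. (\<forall>j<?k. r j < N) \<and> representatives G H L (r \<circ> ?idx)"
    by (intro exI[of _ ?r]) blast
next
  assume "\<exists>r. (\<forall>j<length hs. r j < N) \<and>
    representatives G H L (r \<circ> the_inv_into {..<length hs} ((!) hs))"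
  then show "lhom_yes H (G, L)"
    using representatives_imp_homomorphism[OF assms(5)] by (auto simp: lhom_yes_def)
qed

lemma eval_Representatives_lhom_encode:
  assumes "pair_graph H" "triangle_free H" "distinct hs" "set hs = pverts H"
    and "(G, L) \<in> lhom_instances H" "graph_diameter G \<le> 2"
  defines "x \<equiv> lhom_encode hs (G, L)"
  shows "eval (bits_mem x) (length x) \<rho>
           (Representatives (length hs) (\<lambda>a j. (hs ! a, hs ! j) \<in> parcs H)) =
         of_bool (lhom_yes H (G, L))"
proof -
  let ?k = "length hs" and ?B = "\<lambda>a j. (hs ! a, hs ! j) \<in> parcs H"
  let ?idx = "the_inv_into {..<?k} ((!) hs)"
  obtain n where n: "n = card (pverts G)" by simp
  have G: "pair_graph G" "pverts G = {..<n}" using assms(5) by (auto simp: lhom_instances_def n)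
  interpret encoded_structure "bits_mem x" "length x" n ?k "\<lambda>u v. (u, v) \<in> parcs G"
      "\<lambda>v j. hs ! j \<in> L v"
    unfolding x_def by (rule encoded_structure_lhom_encode) (simp add: n)
  have inj: "inj_on ((!) hs) {..<?k}" using assms(3) by (simp add: inj_on_nth)
  have idx: "?idx (hs ! j) = j" if "j < ?k" for j
    using that by (simp add: the_inv_into_f_f[OF inj])
  have ball: "(\<forall>h \<in> pverts H. Q h) \<longleftrightarrow> (\<forall>j<?k. Q (hs ! j))"
    and bex: "(\<exists>h \<in> pverts H. Q h) \<longleftrightarrow> (\<exists>j<?k. Q (hs ! j))" for Q
    unfolding assms(4)[symmetric] by (auto simp: set_conv_nth)
  have cand: "candidate G H L (r \<circ> ?idx) (hs ! a) u \<longleftrightarrow> cand ?B r a u" for r a u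
    unfolding candidate_def cand_def ball by (auto simp: idx G(2))
  have "representatives G H L (r \<circ> ?idx) \<longleftrightarrow> covered ?B r \<and> compatible ?B r" for r
    unfolding representatives_def ball bex cand G(2) covered_def compatible_def
    by (simp add: idx Ball_def cong: conj_cong)
  then show ?thesis
    unfolding eval_Representatives
    using lhom_yes_iff_representatives[OF assms(1-4) G assms(6) n_less] by simp
qed

text \<open>The term is built from \<open>H\<close> and \<open>hs\<close> alone, so one program and
  one time polynomial serve all inputs.\<close>

theorem theorem4:
  fixes H :: "'a pair_pre_digraph" and hs :: "'a list"
  assumes "pair_graph H"
    and "triangle_free H"
    and "distinct hs" and "set hs = pverts H"
  shows "poly_time_solvable_on (lhom_encode hs)
           {(G, L). (G, L) \<in> lhom_instances H \<and> graph_diameter G \<le> 2}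
           (lhom_yes H)"
  by (rule poly_time_solvable_on_term[where
        t = "Representatives (length hs) (\<lambda>a j. (hs ! a, hs ! j) \<in> parcs H)"])
     (auto simp: eval_Representatives_lhom_encode[OF assms])

end
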